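(* For every real number $c < 2$ there exists a finite simple graph $G$ (not complete) such that every $S \in \Delta_G^*$ satisfies $|S| > c \cdot tw(G)$, where $\Delta_G$ is the set of all minimal separators of $G$ and $\Delta_G^* := \{S \in \Delta_G \mid td(G) = |S| + td(G \setminus S)\}$.
   Context: For $S\subseteq V(G)$, $G\setminus S$ denotes the subgraph induced by $V(G)\setminus S$. For vertices $a,b$, a set $S\subseteq V(G)\setminus\{a,b\}$ is an $a$-$b$ separator if $a$ and $b$ lie in different connected components of $G\setminus S$; it is a minimal $a$-$b$ separator if no proper subset of $S$ is an $a$-$b$ separator. $S$ is a minimal separator of $G$ if it is a minimal $a$-$b$ separator for some $a,b\in V(G)$. A treedepth decomposition of $G$ is a rooted forest $T$ with $V(T)=V(G)$ such that for every edge $uv$ of $G$, one of $u,v$ is an ancestor of the other in $T$. The height of a rooted forest is the maximum number of vertices on a root-to-leaf path. The treedepth $td(G)$ is the minimum height of a treedepth decomposition of $G$. The treewidth $tw(G)$ is the minimum, over all tree decompositions of $G$, of the maximum bag size minus one. *)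

theory Defs
  imports Complex_Main "Graph_Theory.Graph_Theory"
begin

text \<open>
  Finite simple graphs are the digraphs satisfying \<^locale>\<open>graph\<close>: finite, symmetric, without
  loops and without parallel arcs. An edge is represented by its two opposite arcs, and on
  symmetric digraphs the strongly connected components are the connected components.
\<close>

definition delete_verts :: "('a, 'b) pre_digraph \<Rightarrow> 'a set \<Rightarrow> ('a, 'b) pre_digraph" where
  "delete_verts G S = G \<restriction> (verts G - S)"

definition separator :: "('a, 'b) pre_digraph \<Rightarrow> 'a \<Rightarrow> 'a \<Rightarrow> 'a set \<Rightarrow> bool" where
  "separator G a b S \<longleftrightarrow>
     S \<subseteq> verts G - {a, b} \<and>
     (\<exists>C \<in> pre_digraph.sccs_verts (delete_verts G S).
      \<exists>D \<in> pre_digraph.sccs_verts (delete_verts G S). a \<in> C \<and> b \<in> D \<and> C \<noteq> D)"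

definition minimal_separator :: "('a, 'b) pre_digraph \<Rightarrow> 'a \<Rightarrow> 'a \<Rightarrow> 'a set \<Rightarrow> bool" where
  "minimal_separator G a b S \<longleftrightarrow> separator G a b S \<and> (\<forall>S'. S' \<subset> S \<longrightarrow> \<not> separator G a b S')"

definition minimal_separators :: "('a, 'b) pre_digraph \<Rightarrow> 'a set set" where
  "minimal_separators G = {S. \<exists>a \<in> verts G. \<exists>b \<in> verts G. minimal_separator G a b S}"

text \<open>
  A rooted forest on a vertex set is given by its partial parent function; the roots are the
  vertices without a parent, the leaves those that are nobody's parent.
\<close>

definition rooted_forest :: "'a set \<Rightarrow> ('a \<rightharpoonup> 'a) \<Rightarrow> bool" where
  "rooted_forest V p \<longleftrightarrow> dom p \<subseteq> V \<and> ran p \<subseteq> V \<and> acyclic {(u, v). p v = Some u}"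

definition ancestor :: "('a \<rightharpoonup> 'a) \<Rightarrow> 'a \<Rightarrow> 'a \<Rightarrow> bool" where
  "ancestor p u v \<longleftrightarrow> (u, v) \<in> {(u, v). p v = Some u}\<^sup>+"

definition root_leaf_path :: "'a set \<Rightarrow> ('a \<rightharpoonup> 'a) \<Rightarrow> 'a list \<Rightarrow> bool" where
  "root_leaf_path V p xs \<longleftrightarrow>
     xs \<noteq> [] \<and> set xs \<subseteq> V \<and> p (hd xs) = None \<and> last xs \<notin> ran p \<and>
     (\<forall>i. Suc i < length xs \<longrightarrow> p (xs ! Suc i) = Some (xs ! i))"

text \<open>The inserted 0 only matters for the empty forest, which has height 0.\<close>

definition forest_height :: "'a set \<Rightarrow> ('a \<rightharpoonup> 'a) \<Rightarrow> nat" where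
  "forest_height V p = Max (insert 0 {length xs |xs. root_leaf_path V p xs})"

definition treedepth_decomposition :: "('a, 'b) pre_digraph \<Rightarrow> ('a \<rightharpoonup> 'a) \<Rightarrow> bool" where
  "treedepth_decomposition G p \<longleftrightarrow>
     rooted_forest (verts G) p \<and> (\<forall>u v. u \<rightarrow>\<^bsub>G\<^esub> v \<longrightarrow> ancestor p u v \<or> ancestor p v u)"

definition td :: "('a, 'b) pre_digraph \<Rightarrow> nat" where
  "td G = (LEAST h. \<exists>p. treedepth_decomposition G p \<and> forest_height (verts G) p = h)"

text \<open>
  The library's \<^const>\<open>tree\<close> is unsuitable for symmetric digraphs, because there the two arcs of an
  edge already form a \<^const>\<open>pre_digraph.cycle\<close>; undirected cycles are those of length at least 3.
\<close>

definition undirected_tree :: "('a, 'b) pre_digraph \<Rightarrow> bool" where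
  "undirected_tree T \<longleftrightarrow>
     graph T \<and> Digraph_Component.connected T \<and> \<not> (\<exists>c. pre_digraph.cycle T c \<and> 3 \<le> length c)"

text \<open>
  Natural numbers suffice as tree nodes, since finite graphs only need finite decomposition trees.
\<close>

definition tree_decomposition ::
  "('a, 'b) pre_digraph \<Rightarrow> (nat, nat \<times> nat) pre_digraph \<Rightarrow> (nat \<Rightarrow> 'a set) \<Rightarrow> bool" where
  "tree_decomposition G T bag \<longleftrightarrow>
     undirected_tree T \<and>
     (\<Union>t \<in> verts T. bag t) = verts G \<and>
     (\<forall>u v. u \<rightarrow>\<^bsub>G\<^esub> v \<longrightarrow> (\<exists>t \<in> verts T. u \<in> bag t \<and> v \<in> bag t)) \<and>
     (\<forall>v \<in> verts G. Digraph_Component.connected (T \<restriction> {t \<in> verts T. v \<in> bag t}))"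

definition max_bag_size :: "(nat, nat \<times> nat) pre_digraph \<Rightarrow> (nat \<Rightarrow> 'a set) \<Rightarrow> nat" where
  "max_bag_size T bag = Max ((\<lambda>t. card (bag t)) ` verts T)"

text \<open>An integer, so that the empty graph has treewidth \<open>-1\<close>.\<close>

definition tw :: "('a, 'b) pre_digraph \<Rightarrow> int" where
  "tw G = int (LEAST k. \<exists>T bag. tree_decomposition G T bag \<and> max_bag_size T bag = k) - 1"

definition td_optimal_separators :: "('a, 'b) pre_digraph \<Rightarrow> 'a set set" where
  "td_optimal_separators G =
     {S \<in> minimal_separators G. td G = card S + td (delete_verts G S)}"

end

theory Submission
  imports Defs
begin

text \<open>
  Take two cliques of size \<open>k\<close> and join each of them, in half-graph fashion, to the same sequence of
  layers: a vertex of layer \<open>l\<close> sees all but the first \<open>l - 1\<close> blocks of either clique. Exchanging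
  blocks for layers one after the other gives a path decomposition of width about \<open>k\<close>. Deleting
  both cliques leaves only the columns, which have small treedepth, so the treedepth is at most
  about \<open>2k\<close>. Conversely, a set separating parts of the two cliques contains so many vertices that,
  together with one of the cliques, it is too large to lie on a root-to-leaf path of an optimal
  decomposition; hence in every optimal decomposition the two cliques lie on one such path. A
  td-optimal minimal separator missing a vertex of the cliques would then cut off a part of a
  single column, so it would contain the lowest vertex of that column and leave the other columns
  intact; this makes the path exceed the treedepth by one. Therefore every td-optimal minimal
  separator contains both cliques and has at least \<open>2k\<close> vertices.
\<close>

section \<open>Rooted forests\<close>

locale finite_forest =
  fixes V :: "'a set" and p :: "'a \<rightharpoonup> 'a"
  assumes finite_V: "finite V" and forest: "rooted_forest V p"
begin

definition comparable :: "'a \<Rightarrow> 'a \<Rightarrow> bool" where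
  "comparable u v \<longleftrightarrow> u = v \<or> ancestor p u v \<or> ancestor p v u"

definition ancestor_eq :: "'a \<Rightarrow> 'a \<Rightarrow> bool" where
  "ancestor_eq u v \<longleftrightarrow> u = v \<or> ancestor p u v"

definition parent_rel :: "('a \<times> 'a) set" where
  "parent_rel = {(u, v). p v = Some u}"

lemma ancestor_eq_rtrancl: "ancestor_eq u v \<longleftrightarrow> (u, v) \<in> parent_rel\<^sup>*"
  unfolding ancestor_eq_def ancestor_def parent_rel_def by (auto simp: rtrancl_eq_or_trancl)

lemma comparable_iff: "comparable u v \<longleftrightarrow> ancestor_eq u v \<or> ancestor_eq v u"
  by (auto simp: comparable_def ancestor_eq_def)

lemma comparable_sym: "comparable u v \<Longrightarrow> comparable v u"
  by (auto simp: comparable_def)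

lemma ancestor_eq_refl [simp]: "ancestor_eq u u"
  by (simp add: ancestor_eq_def)

lemma ancestor_eq_trans: "ancestor_eq u v \<Longrightarrow> ancestor_eq v w \<Longrightarrow> ancestor_eq u w"
  unfolding ancestor_eq_rtrancl by auto

text \<open>Every vertex has at most one parent, so the way up from \<open>w\<close> is unique and
  passes \<open>u\<close> and \<open>v\<close> one after the other.\<close>

lemma comparable_if_common_descendant:
  assumes "ancestor_eq u w" "ancestor_eq v w"
  shows "comparable u v"
proof -
  have "single_valued (parent_rel\<inverse>)"
    by (auto simp: single_valued_def parent_rel_def)
  moreover have "(w, u) \<in> (parent_rel\<inverse>)\<^sup>*" "(w, v) \<in> (parent_rel\<inverse>)\<^sup>*"
    using assms by (auto simp: ancestor_eq_rtrancl rtrancl_converse)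
  ultimately have "(u, v) \<in> (parent_rel\<inverse>)\<^sup>* \<or> (v, u) \<in> (parent_rel\<inverse>)\<^sup>*"
    by (rule single_valued_confluent)
  then show ?thesis
    by (auto simp: comparable_iff ancestor_eq_rtrancl rtrancl_converse)
qed

lemma acyclic_parent_rel: "acyclic parent_rel"
  using forest by (simp add: rooted_forest_def parent_rel_def)

lemma finite_parent_rel: "finite parent_rel"
proof (rule finite_subset)
  show "parent_rel \<subseteq> V \<times> V"
    using forest by (auto simp: rooted_forest_def parent_rel_def dom_def ran_def)
qed (simp add: finite_V)

lemma ancestor_irrefl: "\<not> ancestor p u u"
  using acyclic_parent_rel by (simp add: acyclic_def ancestor_def parent_rel_def)

definition root_path :: "'a list \<Rightarrow> bool" where
  "root_path xs \<longleftrightarrow> xs \<noteq> [] \<and> set xs \<subseteq> V \<and> p (hd xs) = None \<and>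
     (\<forall>i. Suc i < length xs \<longrightarrow> p (xs ! Suc i) = Some (xs ! i))"

lemma root_path_snoc:
  assumes "root_path xs" "p v = Some (last xs)"
  shows "root_path (xs @ [v])"
proof -
  have "v \<in> V"
    using assms(2) forest by (auto simp: rooted_forest_def dom_def)
  moreover have "p ((xs @ [v]) ! Suc i) = Some ((xs @ [v]) ! i)" if "Suc i < length (xs @ [v])" for i
  proof (cases "Suc i < length xs")
    case True
    then show ?thesis using assms(1) by (simp add: root_path_def nth_append)
  next
    case False
    then have "i = length xs - 1" "xs \<noteq> []"
      using that assms(1) by (auto simp: root_path_def)
    then show ?thesis using assms(2) by (simp add: nth_append last_conv_nth)
  qed
  ultimately show ?thesis
    using assms(1) by (simp add: root_path_def)
qed

lemma ex_root_path: "v \<in> V \<Longrightarrow> \<exists>xs. root_path xs \<and> last xs = v"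
proof (induction v rule: wf_induct_rule[OF finite_acyclic_wf[OF finite_parent_rel acyclic_parent_rel]])
  case (1 v)
  show ?case
  proof (cases "p v")
    case None
    then have "root_path [v]" using 1 by (simp add: root_path_def)
    then show ?thesis by force
  next
    case (Some u)
    then have "u \<in> V"
      using forest by (auto simp: rooted_forest_def ran_def)
    with Some obtain xs where "root_path xs" "last xs = u"
      using 1 by (auto simp: parent_rel_def)
    then show ?thesis
      using root_path_snoc[of xs v] Some by force
  qed
qed

lemma root_path_extends_to_leaf:
  "root_path xs \<Longrightarrow> \<exists>ys. root_leaf_path V p ys \<and> set xs \<subseteq> set ys"
proof (induction "last xs" arbitrary: xs
    rule: wf_induct_rule[OF finite_acyclic_wf_converse[OF finite_parent_rel acyclic_parent_rel]])
  case (1 xs)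
  show ?case
  proof (cases "last xs \<in> ran p")
    case True
    then obtain w where w: "p w = Some (last xs)" by (auto simp: ran_def)
    then have "root_path (xs @ [w])" using 1 root_path_snoc by blast
    with 1(1)[of "xs @ [w]"] w obtain ys
      where "root_leaf_path V p ys \<and> set (xs @ [w]) \<subseteq> set ys"
      by (auto simp: parent_rel_def)
    then show ?thesis by auto
  next
    case False
    then show ?thesis using 1 by (auto simp: root_path_def root_leaf_path_def)
  qed
qed

lemma root_leaf_path_ancestor_closed:
  assumes "root_leaf_path V p xs" "w \<in> set xs" "ancestor_eq u w"
  shows "u \<in> set xs"
proof -
  have step: "u \<in> set xs" if w: "w \<in> set xs" and "p w = Some u" for u w
  proof -
    obtain i where i: "i < length xs" "w = xs ! i"
      using w by (auto simp: in_set_conv_nth)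
    show ?thesis
    proof (cases i)
      case 0
      then show ?thesis
        using i that assms(1) by (auto simp: root_leaf_path_def hd_conv_nth)
    next
      case (Suc j)
      then show ?thesis
        using i that assms(1) by (auto simp: root_leaf_path_def)
    qed
  qed
  have "(u, w) \<in> parent_rel\<^sup>*" using assms(3) by (simp add: ancestor_eq_rtrancl)
  then show ?thesis
    using assms(2)
    by (induction rule: rtrancl_induct) (auto simp: parent_rel_def intro: step)
qed

text \<open>Later entries are strict descendants of earlier ones, so none repeats. The bound keeps
  the set under \<open>Max\<close> in \<open>forest_height\<close> finite.\<close>

lemma length_root_leaf_path_le:
  assumes "root_leaf_path V p xs"
  shows "length xs \<le> card V"
proof -
  have less: "ancestor p (xs ! i) (xs ! j)" if "i < j" "j < length xs" for i j
    using that
  proof (induction j)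
    case (Suc j)
    have edge: "(xs ! j, xs ! Suc j) \<in> {(u, v). p v = Some u}"
      using assms Suc.prems by (simp add: root_leaf_path_def)
    show ?case
    proof (cases "i = j")
      case True
      then show ?thesis using edge unfolding ancestor_def by (metis r_into_trancl)
    next
      case False
      then show ?thesis using Suc edge unfolding ancestor_def
        by (metis Suc_lessD less_SucE trancl.trancl_into_trancl)
    qed
  qed simp
  have "distinct xs"
    unfolding distinct_conv_nth using less ancestor_irrefl by (metis linorder_neqE_nat)
  then have "length xs = card (set xs)" by (simp add: distinct_card)
  also have "\<dots> \<le> card V"
    using assms finite_V by (intro card_mono) (auto simp: root_leaf_path_def)
  finally show ?thesis .
qed

lemma length_root_leaf_path_le_height:
  assumes "root_leaf_path V p xs"
  shows "length xs \<le> forest_height V p"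
  unfolding forest_height_def
proof (rule Max_ge)
  have "{length xs |xs. root_leaf_path V p xs} \<subseteq> {..card V}"
    using length_root_leaf_path_le by auto
  then show "finite (insert 0 {length xs |xs. root_leaf_path V p xs})"
    by (simp add: finite_subset)
qed (use assms in auto)

lemma chain_has_bottom:
  assumes "finite C" "C \<noteq> {}" "\<And>u v. u \<in> C \<Longrightarrow> v \<in> C \<Longrightarrow> comparable u v"
  shows "\<exists>z\<in>C. \<forall>c\<in>C. ancestor_eq c z"
  using assms
proof (induction C rule: finite_ne_induct)
  case (insert x F)
  then obtain z where "z \<in> F" "\<forall>c\<in>F. ancestor_eq c z" by auto
  moreover from this insert.prems[of x z] have "ancestor_eq x z \<or> ancestor_eq z x"
    by (auto simp: comparable_iff)
  ultimately show ?case
    by (metis ancestor_eq_refl ancestor_eq_trans insertE insertI1 insertI2)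
qed simp

text \<open>The source of all lower bounds on heights: a chain lies on the path from a root to its
  lowest element, and this path extends to a leaf.\<close>

lemma card_chain_le_height:
  assumes "C \<subseteq> V" and "\<And>u v. u \<in> C \<Longrightarrow> v \<in> C \<Longrightarrow> comparable u v"
  shows "card C \<le> forest_height V p"
proof (cases "C = {}")
  case False
  have "finite C" using assms(1) finite_V by (rule finite_subset)
  then obtain z where z: "z \<in> C" "\<forall>c\<in>C. ancestor_eq c z"
    using chain_has_bottom[OF _ False] assms(2) by blast
  then obtain xs where xs: "root_path xs" "last xs = z"
    using ex_root_path assms(1) by blast
  then obtain ys where ys: "root_leaf_path V p ys" "set xs \<subseteq> set ys"
    using root_path_extends_to_leaf by blast
  have "z \<in> set ys"
    using xs ys by (auto simp: root_path_def)
  then have "C \<subseteq> set ys"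
    using z root_leaf_path_ancestor_closed[OF ys(1)] by blast
  then have "card C \<le> length ys"
    by (meson List.finite_set card_length card_mono le_trans)
  also have "\<dots> \<le> forest_height V p"
    using ys(1) by (rule length_root_leaf_path_le_height)
  finally show ?thesis .
qed simp

text \<open>
  Growing a vertex set along edges of the decomposed graph preserves the existence of a topmost
  vertex; hence every connected vertex set has one.
\<close>

lemma topmost_insert:
  assumes "\<exists>u\<in>C. \<forall>c\<in>C. ancestor_eq u c" "c \<in> C" "comparable v c"
  shows "\<exists>u\<in>insert v C. \<forall>c\<in>insert v C. ancestor_eq u c"
proof -
  obtain u where u: "u \<in> C" "\<forall>c\<in>C. ancestor_eq u c" using assms(1) by blast
  have "comparable u v"
  proof (cases "ancestor_eq v c")
    case True
    then show ?thesis using u assms(2) comparable_if_common_descendant by blast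
  next
    case False
    then have "ancestor_eq u v"
      using u assms(2,3) ancestor_eq_trans unfolding comparable_iff by blast
    then show ?thesis by (simp add: comparable_iff)
  qed
  then consider "ancestor_eq u v" | "ancestor_eq v u" by (auto simp: comparable_iff)
  then show ?thesis
  proof cases
    case 1
    then show ?thesis using u by auto
  next
    case 2
    then have "\<forall>c\<in>C. ancestor_eq v c" using u ancestor_eq_trans by blast
    then show ?thesis by auto
  qed
qed

lemma comparable_refl: "comparable u u"
  by (simp add: comparable_def)

text \<open>An element of \<open>Q\<close> is above \<open>s\<close>, sharing this descendant with
  all of \<open>A\<close>, or below \<open>s\<close> and thus below all of \<open>A\<close>.\<close>

lemma comparable_Un_ancestors:
  assumes "\<And>u. u \<in> A \<Longrightarrow> ancestor_eq u s" "s \<in> Q"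
    and "\<And>u v. u \<in> Q \<Longrightarrow> v \<in> Q \<Longrightarrow> comparable u v"
    and "u \<in> A \<union> Q" "v \<in> A \<union> Q"
  shows "comparable u v"
proof -
  have mixed: "comparable x y" if "x \<in> A" "y \<in> Q" for x y
  proof (cases "ancestor_eq y s")
    case True
    then show ?thesis using comparable_if_common_descendant assms(1) that(1) by blast
  next
    case False
    then have "ancestor_eq s y" using assms(2,3) that(2) by (auto simp: comparable_iff)
    then show ?thesis
      using ancestor_eq_trans assms(1) that(1) by (auto simp: comparable_iff)
  qed
  show ?thesis
    using assms mixed comparable_if_common_descendant comparable_sym by blast
qed

end

section \<open>Bounding and attaining the treedepth\<close>

lemma forest_height_le:
  assumes "\<And>v. v \<in> V \<Longrightarrow> p v = None \<Longrightarrow> dep v = 0"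
    and "\<And>u v. v \<in> V \<Longrightarrow> p v = Some u \<Longrightarrow> dep v = Suc (dep u)"
    and "\<And>v. v \<in> V \<Longrightarrow> dep v < h"
  shows "forest_height V p \<le> h"
proof -
  have len: "length xs \<le> h" if xs: "root_leaf_path V p xs" for xs
  proof -
    have "dep (xs ! i) = i" if "i < length xs" for i
      using that
    proof (induction i)
      case 0
      then have "xs ! 0 \<in> V" "p (xs ! 0) = None"
        using xs by (auto simp: root_leaf_path_def hd_conv_nth subset_iff)
      then show ?case using assms(1) by simp
    next
      case (Suc i)
      then have "xs ! Suc i \<in> V" "p (xs ! Suc i) = Some (xs ! i)"
        using xs by (auto simp: root_leaf_path_def subset_iff)
      then show ?case using Suc assms(2) by simp
    qed
    moreover have "xs ! (length xs - 1) \<in> V" "length xs - 1 < length xs"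
      using xs by (auto simp: root_leaf_path_def subset_iff)
    ultimately show ?thesis using assms(3) by fastforce
  qed
  have "{length xs |xs. root_leaf_path V p xs} \<subseteq> {..h}" using len by auto
  then have "finite (insert 0 {length xs |xs. root_leaf_path V p xs})"
    by (simp add: finite_subset)
  then show ?thesis
    unfolding forest_height_def using len by (subst Max_le_iff) auto
qed

text \<open>Chaining all vertices in their linear order makes any two of them comparable. This gives
  the \<open>LEAST\<close> in \<open>td\<close> a witness.\<close>

lemma ex_treedepth_decomposition:
  fixes G :: "('a::linorder, 'b) pre_digraph"
  assumes "fin_digraph G" "\<And>v. \<not> v \<rightarrow>\<^bsub>G\<^esub> v"
  shows "\<exists>p. treedepth_decomposition G p"
proof -
  interpret fin_digraph G by fact
  define below where "below v = {u \<in> verts G. u < v}" for v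
  have fin: "finite (below v)" for v by (simp add: below_def)
  define p where "p v = (if v \<in> verts G \<and> below v \<noteq> {} then Some (Max (below v)) else None)" for v
  have p_less: "u \<in> below v \<and> v \<in> verts G" if "p v = Some u" for u v
    using that Max_in[OF fin[of v]] by (auto simp: p_def split: if_splits)
  have "acyclic ({(u, v). p v = Some u}\<inverse>)"
    by (rule acyclicI_order[where f = id]) (use p_less in \<open>auto simp: below_def\<close>)
  then have "rooted_forest (verts G) p"
    using p_less by (auto simp: rooted_forest_def dom_def ran_def below_def)
  \<comment> \<open>The order on the type need not be well-founded, so the induction is on the
    number of vertices below \<open>v\<close>.\<close>
  moreover have anc: "ancestor p u v" if "u < v" "u \<in> verts G" "v \<in> verts G" for u v
    using that
  proof (induction "card (below v)" arbitrary: v rule: less_induct)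
    case less
    let ?m = "Max (below v)"
    have u: "u \<in> below v" using less.prems by (simp add: below_def)
    then have m: "?m \<in> below v" "p v = Some ?m" "u \<le> ?m"
      using fin less.prems(3) by (auto simp: p_def intro: Max_in)
    show ?case
    proof (cases "u = ?m")
      case True
      then have "p v = Some u" using m(2) by simp
      then show ?thesis by (auto simp: ancestor_def intro: r_into_trancl)
    next
      case False
      have "below ?m \<subset> below v"
        using m(1) unfolding below_def by force
      then have "card (below ?m) < card (below v)" by (rule psubset_card_mono[OF fin])
      moreover have "u < ?m" "?m \<in> verts G"
        using m False by (auto simp: below_def)
      ultimately have "ancestor p u ?m"
        using less.hyps[of ?m] less.prems(2) by blast
      then show ?thesis
        using m(2) unfolding ancestor_def by (auto intro: trancl_into_trancl)
    qed
  qed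
  ultimately have "treedepth_decomposition G p"
    using assms(2) adj_in_verts unfolding treedepth_decomposition_def by (metis linorder_neqE)
  then show ?thesis by blast
qed

lemma td_attained:
  fixes G :: "('a::linorder, 'b) pre_digraph"
  assumes "fin_digraph G" "\<And>v. \<not> v \<rightarrow>\<^bsub>G\<^esub> v"
  obtains p where "treedepth_decomposition G p" "forest_height (verts G) p = td G"
proof -
  have "\<exists>h p. treedepth_decomposition G p \<and> forest_height (verts G) p = h"
    using ex_treedepth_decomposition[OF assms] by blast
  then have "\<exists>p. treedepth_decomposition G p \<and> forest_height (verts G) p = td G"
    unfolding td_def by (rule LeastI_ex)
  then show thesis using that by blast
qed

lemma td_le:
  assumes "treedepth_decomposition G p" "forest_height (verts G) p \<le> h"
  shows "td G \<le> h"
proof -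
  have "td G \<le> forest_height (verts G) p"
    unfolding td_def by (rule Least_le) (use assms in blast)
  then show ?thesis using assms(2) by simp
qed

section \<open>Separators\<close>

lemma dominates_delete_verts_iff:
  "u \<rightarrow>\<^bsub>delete_verts G S\<^esub> v \<longleftrightarrow> u \<rightarrow>\<^bsub>G\<^esub> v \<and> u \<in> verts G - S \<and> v \<in> verts G - S"
  by (force simp: delete_verts_def arcs_ends_conv)

text \<open>Replaces components by a set that no edge leaves, so that cuts can be checked edge by
  edge. By symmetry, the set reachable from \<open>a\<close> is its component.\<close>

lemma separator_iff_closed_set:
  assumes "sym_digraph G"
  shows "separator G a b S \<longleftrightarrow> S \<subseteq> verts G - {a, b} \<and>
    (\<exists>K \<subseteq> verts G - S. a \<in> K \<and> b \<in> verts G - S - K \<and>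
       (\<forall>u\<in>K. \<forall>v\<in>verts G - S. u \<rightarrow>\<^bsub>G\<^esub> v \<longrightarrow> v \<in> K))"
proof -
  interpret sym_digraph G by fact
  let ?H = "delete_verts G S"
  have verts_H [simp]: "verts ?H = verts G - S" by (simp add: delete_verts_def)
  interpret H: wf_digraph ?H by (simp add: delete_verts_def wellformed_induce_subgraph)
  have sym: "symmetric ?H"
    using sym_arcs unfolding symmetric_def sym_def dominates_delete_verts_iff by blast
  note reach_sym = symmetric_reachable[OF sym]
  show ?thesis
  proof
    assume sep: "separator G a b S"
    then obtain C D where CD: "C \<in> H.sccs_verts" "D \<in> H.sccs_verts" "a \<in> C" "b \<in> D" "C \<noteq> D"
      by (auto simp: separator_def)
    define K where "K = {v. a \<rightarrow>\<^sup>*\<^bsub>?H\<^esub> v}"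
    have "b \<notin> K"
    proof
      assume "b \<in> K"
      then have "b \<in> C" using CD(1,3) reach_sym unfolding K_def H.sccs_verts_def by blast
      then show False using CD H.sccs_verts_disjoint by blast
    qed
    moreover have ab: "a \<in> verts G - S" "b \<in> verts G - S"
      using CD H.sccs_verts_subsets by auto
    moreover have "a \<in> K"
      using ab by (simp add: K_def)
    moreover have K_sub: "K \<subseteq> verts G - S"
      using H.reachable_in_verts(2) by (auto simp: K_def)
    moreover have "v \<in> K" if "u \<in> K" "v \<in> verts G - S" "u \<rightarrow>\<^bsub>G\<^esub> v" for u v
    proof -
      have "u \<rightarrow>\<^bsub>?H\<^esub> v"
        using that K_sub by (auto simp: dominates_delete_verts_iff)
      then show ?thesis
        using that(1) H.reachable_adj_trans unfolding K_def by blast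
    qed
    ultimately show "S \<subseteq> verts G - {a, b} \<and>
      (\<exists>K \<subseteq> verts G - S. a \<in> K \<and> b \<in> verts G - S - K \<and>
       (\<forall>u\<in>K. \<forall>v\<in>verts G - S. u \<rightarrow>\<^bsub>G\<^esub> v \<longrightarrow> v \<in> K))"
      using sep by (intro conjI exI[of _ K]) (auto simp: separator_def)
  next
    assume R: "S \<subseteq> verts G - {a, b} \<and>
      (\<exists>K \<subseteq> verts G - S. a \<in> K \<and> b \<in> verts G - S - K \<and>
       (\<forall>u\<in>K. \<forall>v\<in>verts G - S. u \<rightarrow>\<^bsub>G\<^esub> v \<longrightarrow> v \<in> K))"
    then obtain K where K: "K \<subseteq> verts G - S" "a \<in> K" "b \<in> verts G - S - K"
      and K_closed: "\<forall>u\<in>K. \<forall>v\<in>verts G - S. u \<rightarrow>\<^bsub>G\<^esub> v \<longrightarrow> v \<in> K"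
      by (elim conjE exE) (rule that)
    have "v \<in> K" if "a \<rightarrow>\<^sup>*\<^bsub>?H\<^esub> v" for v
      using that by (induction rule: H.reachable_induct)
        (use K(2) K_closed in \<open>auto simp: dominates_delete_verts_iff\<close>)
    then have "\<not> a \<rightarrow>\<^sup>*\<^bsub>?H\<^esub> b" using K(3) by blast
    moreover have "a \<rightarrow>\<^sup>*\<^bsub>?H\<^esub> a" "b \<rightarrow>\<^sup>*\<^bsub>?H\<^esub> b"
      using K by auto
    ultimately have "a \<in> H.scc_of a" "b \<in> H.scc_of b" "H.scc_of a \<noteq> H.scc_of b"
      unfolding H.scc_of_def by blast+
    moreover have "H.scc_of a \<in> H.sccs_verts" "H.scc_of b \<in> H.sccs_verts"
      using K by (auto intro!: H.scc_of_in_sccs_verts)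
    ultimately show "separator G a b S"
      using R unfolding separator_def by blast
  qed
qed

section \<open>Path decompositions\<close>

definition graph_of :: "'a set \<Rightarrow> ('a \<Rightarrow> 'a \<Rightarrow> bool) \<Rightarrow> ('a, 'a \<times> 'a) pre_digraph" where
  "graph_of V E = \<lparr>verts = V, arcs = {(u, v). u \<in> V \<and> v \<in> V \<and> E u v}, tail = fst, head = snd\<rparr>"

lemma verts_graph_of [simp]: "verts (graph_of V E) = V"
  by (simp add: graph_of_def)

lemma dominates_graph_of [simp]:
  "u \<rightarrow>\<^bsub>graph_of V E\<^esub> v \<longleftrightarrow> u \<in> V \<and> v \<in> V \<and> E u v"
  by (force simp: graph_of_def arcs_ends_conv)

lemma graph_graph_of:
  assumes "finite V" "symp E" "irreflp E"
  shows "graph (graph_of V E)"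
proof -
  have "finite {(u, v). u \<in> V \<and> v \<in> V \<and> E u v}"
    by (rule finite_subset[of _ "V \<times> V"]) (use assms(1) in auto)
  moreover have "symmetric (graph_of V E)"
    using assms(2) by (auto simp: symmetric_def sym_def symp_def)
  ultimately show ?thesis
    by unfold_locales
      (use assms in \<open>auto simp: graph_of_def arc_to_ends_def irreflp_def\<close>)
qed

definition path_graph :: "nat \<Rightarrow> (nat, nat \<times> nat) pre_digraph" where
  "path_graph m = graph_of {..<m} (\<lambda>i j. j = Suc i \<or> i = Suc j)"

lemma verts_path_graph [simp]: "verts (path_graph m) = {..<m}"
  by (simp add: path_graph_def)

lemma graph_path_graph: "graph (path_graph m)"
  unfolding path_graph_def by (rule graph_graph_of) (auto simp: symp_def irreflp_def)

text \<open>Walking upwards by single steps stays in \<open>I\<close> by convexity. One direction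
  suffices because \<open>connected\<close> refers to the symmetric closure.\<close>

lemma connected_path_graph_interval:
  assumes "I \<subseteq> {..<m}" "I \<noteq> {}"
    and convex: "\<And>i j l. i \<in> I \<Longrightarrow> l \<in> I \<Longrightarrow> i \<le> j \<Longrightarrow> j \<le> l \<Longrightarrow> j \<in> I"
  shows "Digraph_Component.connected (path_graph m \<restriction> I)"
proof -
  interpret graph "path_graph m" by (rule graph_path_graph)
  let ?H = "path_graph m \<restriction> I"
  interpret H: wf_digraph ?H by (rule wellformed_induce_subgraph)
  have edge: "i \<rightarrow>\<^bsub>?H\<^esub> Suc i" if "i \<in> I" "Suc i \<in> I" for i
  proof -
    have "(i, Suc i) \<in> arcs ?H"
      using that assms(1) by (auto simp: path_graph_def graph_of_def)
    then show ?thesis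
      by (rule H.dominatesI[rotated]) (simp add: arc_to_ends_def path_graph_def graph_of_def)
  qed
  have up: "i \<rightarrow>\<^sup>*\<^bsub>?H\<^esub> j" if "i \<le> j" "i \<in> I" "j \<in> I" for i j
    using that
  proof (induction j rule: dec_induct)
    case (step j)
    then have j: "j \<in> I" using convex[of i "Suc j" j] by simp
    then have "i \<rightarrow>\<^sup>*\<^bsub>?H\<^esub> j" using step by simp
    also have "j \<rightarrow>\<^bsub>?H\<^esub> Suc j" using edge j step.prems by blast
    finally show ?case .
  qed simp
  show ?thesis
  proof (rule H.connectedI)
    fix i j assume "i \<in> verts ?H" "j \<in> verts ?H"
    then have "i \<rightarrow>\<^sup>*\<^bsub>?H\<^esub> j \<or> j \<rightarrow>\<^sup>*\<^bsub>?H\<^esub> i"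
      using up[of i j] up[of j i] nat_le_linear[of i j] by auto
    then show "i \<rightarrow>\<^sup>*\<^bsub>mk_symmetric ?H\<^esub> j"
      by (elim disjE) (simp_all add: H.reachable_mk_symmetricI
          symmetric_reachable[OF symmetric_mk_symmetric H.reachable_mk_symmetricI])
  qed (use assms(2) in simp)
qed

text \<open>The largest vertex of a cycle has only one smaller neighbour, which the cycle would
  visit both before and after it.\<close>

lemma undirected_tree_path_graph:
  assumes "0 < m"
  shows "undirected_tree (path_graph m)"
proof -
  interpret graph "path_graph m" by (rule graph_path_graph)
  have "path_graph m = path_graph m \<restriction> {..<m}"
    by (auto simp: path_graph_def graph_of_def induce_subgraph_def)
  then have "Digraph_Component.connected (path_graph m)"
    using connected_path_graph_interval[of "{..<m}" m] assms by auto
  moreover have False if cyc: "cycle c" and len: "3 \<le> length c" for c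
  proof -
    obtain u where walk: "awalk u c u" and dist: "distinct (tl (awalk_verts u c))"
      using cyc by (auto simp: cycle_def)
    define vs where "vs = awalk_verts u c"
    let ?n = "length c"
    have vs_len: "length vs = Suc ?n" by (simp add: vs_def length_awalk_verts)
    have cas: "cas u c u" using walk by blast
    have ends: "vs ! 0 = u" "vs ! ?n = u"
      using awhd_of_awalk[OF walk] awlast_if_cas[OF cas] vs_len
      by (auto simp: vs_def hd_conv_nth last_conv_nth)
    have step: "vs ! Suc i = Suc (vs ! i) \<or> vs ! i = Suc (vs ! Suc i)" if "i < ?n" for i
    proof -
      have "c ! i \<in> arcs (path_graph m)" using walk that by (auto simp: awalk_def)
      then have "head (path_graph m) (c ! i) = Suc (tail (path_graph m) (c ! i)) \<or>
          tail (path_graph m) (c ! i) = Suc (head (path_graph m) (c ! i))"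
        by (auto simp: path_graph_def graph_of_def)
      moreover have "vs ! i = tail (path_graph m) (c ! i)"
        using that len by (auto simp: vs_def awalk_verts_conv nth_append)
      moreover have "vs ! Suc i = head (path_graph m) (c ! i)"
        using that cas len by (auto simp: vs_def awalk_verts_conv'[OF cas])
      ultimately show ?thesis by simp
    qed
    \<comment> \<open>First and last entry of \<open>vs\<close> agree, so distinctness starts at
      position 1.\<close>
    have inj: "i = j" if eq: "vs ! i = vs ! j" and pos: "0 < i" "0 < j" and le: "i \<le> ?n" "j \<le> ?n" for i j
    proof -
      obtain i' j' where ij: "i = Suc i'" "j = Suc j'"
        using pos by (auto simp: gr0_conv_Suc)
      have less: "i' < length (tl vs)" "j' < length (tl vs)"
        using le ij vs_len by auto
      then have "tl vs ! i' = tl vs ! j'"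
        using eq ij by (simp add: nth_tl)
      then show ?thesis
        using nth_eq_iff_index_eq[OF dist[folded vs_def] less] ij by blast
    qed
    have "Max ((!) vs ` {1..?n}) \<in> (!) vs ` {1..?n}"
      using len by (intro Max_in) auto
    then obtain i where i: "1 \<le> i" "i \<le> ?n" and i_max: "vs ! i = Max ((!) vs ` {1..?n})"
      by auto
    have ub: "vs ! j \<le> vs ! i" if "j \<le> ?n" for j
    proof -
      have "vs ! j \<in> (!) vs ` {1..?n}"
      proof (cases "j = 0")
        case True
        then have "vs ! j = vs ! ?n" using ends by simp
        then show ?thesis using len by (intro image_eqI[of _ _ ?n]) auto
      next
        case False
        then show ?thesis using that by (intro imageI) simp
      qed
      then show ?thesis unfolding i_max by (intro Max_ge) auto
    qed
    \<comment> \<open>Both neighbours of the maximum on the cycle are its predecessor in the path.\<close>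
    define next_i where "next_i = (if i = ?n then 1 else Suc i)"
    have "Suc (vs ! (i - 1)) = vs ! i"
    proof -
      obtain i' where i': "i = Suc i'" using i by (cases i) auto
      then have "i' < ?n" "i' \<le> ?n" using i by auto
      then show ?thesis using step[of i'] ub[of i'] unfolding i' diff_Suc_1 by linarith
    qed
    moreover have "Suc (vs ! next_i) = vs ! i"
    proof (cases "i = ?n")
      case True
      then have next_i: "next_i = Suc 0" and "vs ! i = vs ! 0"
        using ends by (simp_all add: next_i_def)
      moreover have "0 < ?n" "Suc 0 \<le> ?n" using len by auto
      ultimately show ?thesis using step[of 0] ub[of "Suc 0"] unfolding next_i by linarith
    next
      case False
      then have next_i: "next_i = Suc i" and "i < ?n" using i by (simp_all add: next_i_def)
      then show ?thesis using step[of i] ub[of "Suc i"] unfolding next_i by linarith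
    qed
    ultimately have same: "vs ! (i - 1) = vs ! next_i" by linarith
    \<comment> \<open>Position 0 is replaced by \<open>?n\<close>, which carries the same vertex, so
      that \<open>inj\<close> applies.\<close>
    define prev_i where "prev_i = (if i = 1 then ?n else i - 1)"
    have "vs ! prev_i = vs ! (i - 1)"
    proof (cases "i = 1")
      case True
      then show ?thesis using ends by (simp add: prev_i_def)
    next
      case False
      then show ?thesis by (simp add: prev_i_def)
    qed
    then have "vs ! prev_i = vs ! next_i" using same by (rule trans)
    moreover have "0 < prev_i" "0 < next_i" "prev_i \<le> ?n" "next_i \<le> ?n"
      using i len unfolding prev_i_def next_i_def by (cases "i = 1"; cases "i = ?n"; auto)+
    ultimately have "prev_i = next_i" by (rule inj)
    \<comment> \<open>Length at least 3 matters here: for length 2 the two positions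
      coincide.\<close>
    moreover have "prev_i \<noteq> next_i"
      using i len unfolding prev_i_def next_i_def by (cases "i = 1"; cases "i = ?n") auto
    ultimately show False by contradiction
  qed
  ultimately show ?thesis
    using graph_path_graph unfolding undirected_tree_def by blast
qed

text \<open>Convexity makes the bags containing a vertex an interval of the path. The bound from
  below holds because every tree decomposition of a nonempty graph has a nonempty bag.\<close>

lemma tw_le_path_decomposition:
  fixes bag :: "nat \<Rightarrow> 'a set"
  assumes "0 < m"
    and "(\<Union>t<m. bag t) = verts G"
    and "\<And>u v. u \<rightarrow>\<^bsub>G\<^esub> v \<Longrightarrow> \<exists>t<m. u \<in> bag t \<and> v \<in> bag t"
    and "\<And>v i j l. v \<in> bag i \<Longrightarrow> v \<in> bag l \<Longrightarrow> i \<le> j \<Longrightarrow> j \<le> l \<Longrightarrow> l < m \<Longrightarrow> v \<in> bag j"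
    and "\<And>t. t < m \<Longrightarrow> card (bag t) \<le> w"
    and "finite (verts G)" "verts G \<noteq> {}"
  shows "0 \<le> tw G" "tw G \<le> int w - 1"
proof -
  let ?P = "\<lambda>k. \<exists>T bag. tree_decomposition G T bag \<and> max_bag_size T bag = k"
  have "Digraph_Component.connected (path_graph m \<restriction> {t \<in> verts (path_graph m). v \<in> bag t})"
    if v: "v \<in> verts G" for v
  proof (rule connected_path_graph_interval)
    show "{t \<in> verts (path_graph m). v \<in> bag t} \<noteq> {}"
      using v assms(2) by auto
  next
    fix i j l
    assume "i \<in> {t \<in> verts (path_graph m). v \<in> bag t}" "l \<in> {t \<in> verts (path_graph m). v \<in> bag t}"
      "i \<le> j" "j \<le> l"
    then show "j \<in> {t \<in> verts (path_graph m). v \<in> bag t}"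
      using assms(4)[of v i l j] by simp
  qed auto
  then have dec: "tree_decomposition G (path_graph m) bag"
    unfolding tree_decomposition_def
    using undirected_tree_path_graph[OF assms(1)] assms(2,3) by (auto simp: Bex_def)
  have "(LEAST k. ?P k) \<le> max_bag_size (path_graph m) bag"
    by (rule Least_le) (use dec in blast)
  also have "\<dots> \<le> w"
    unfolding max_bag_size_def by (rule Max.boundedI) (use assms(1,5) in auto)
  finally show "tw G \<le> int w - 1" by (simp add: tw_def)
  have "?P (LEAST k. ?P k)"
    by (rule LeastI_ex) (use dec in blast)
  then obtain T bag' where T: "tree_decomposition G T bag'" "max_bag_size T bag' = (LEAST k. ?P k)"
    by blast
  interpret T: graph T using T(1) by (simp add: tree_decomposition_def undirected_tree_def)
  obtain v t where t: "t \<in> verts T" "v \<in> bag' t" "bag' t \<subseteq> verts G"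
    using T(1) assms(7) unfolding tree_decomposition_def by blast
  then have "0 < card (bag' t)"
    using assms(6) by (auto simp: card_gt_0_iff intro: finite_subset)
  also have "card (bag' t) \<le> max_bag_size T bag'"
    unfolding max_bag_size_def by (rule Max_ge) (use t T.finite_verts in auto)
  finally show "0 \<le> tw G" using T(2) by (simp add: tw_def)
qed

section \<open>The extremal graph\<close>

text \<open>
  With \<open>r = D + 2\<close> and \<open>k = D * r\<close>, the vertices are numbered consecutively: a first clique
  \<open>[0, k)\<close>, a second clique \<open>[k, 2k)\<close>, each made of \<open>D\<close> blocks of size \<open>r\<close>, and then \<open>D + 1\<close>
  layers of size \<open>r\<close>. The columns of the layers, i.e. the residue classes modulo \<open>r\<close>, are cliques
  as well.
\<close>

locale gap_graph =
  fixes D :: nat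
  assumes D_pos: "0 < D"
begin

text \<open>\<open>r\<close> exceeds the \<open>D + 1\<close> vertices of a column by one, which
  puts the treedepth bound \<open>2 * k + D + 1\<close> just below \<open>2 * k + r\<close>, the
  size that cuts force.\<close>

definition r :: nat where "r = D + 2"
definition k :: nat where "k = D * r"
definition n :: nat where "n = 3 * k + r"

definition block :: "nat \<Rightarrow> nat" where "block s = s mod k div r"
definition layer :: "nat \<Rightarrow> nat" where "layer w = (w - 2 * k) div r"

text \<open>The \<open>Suc\<close> is an overlap of one layer: the layers below \<open>w\<close> and
  the blocks that \<open>w\<close> sees in one clique then make up \<open>k + r\<close> vertices
  instead of \<open>k\<close>.\<close>

definition cross :: "nat \<Rightarrow> nat \<Rightarrow> bool" where
  "cross s w \<longleftrightarrow> s < 2 * k \<and> 2 * k \<le> w \<and> layer w \<le> Suc (block s)"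

definition adj :: "nat \<Rightarrow> nat \<Rightarrow> bool" where
  "adj u v \<longleftrightarrow> u \<noteq> v \<and> (u < k \<and> v < k \<or> u \<in> {k..<2 * k} \<and> v \<in> {k..<2 * k} \<or>
     2 * k \<le> u \<and> 2 * k \<le> v \<and> u mod r = v mod r \<or> cross u v \<or> cross v u)"

definition gap :: "(nat, nat \<times> nat) pre_digraph" where
  "gap = graph_of {..<n} adj"

lemma r_pos: "0 < r" by (simp add: r_def)

lemma r_le_k: "r \<le> k" using D_pos by (simp add: k_def)

lemma k_pos: "0 < k" using r_pos r_le_k by linarith

lemma adj_sym: "adj u v \<Longrightarrow> adj v u" by (auto simp: adj_def)

lemma adj_irrefl: "\<not> adj u u" by (simp add: adj_def)

lemma graph_gap: "graph gap"
  unfolding gap_def by (rule graph_graph_of) (auto simp: symp_def irreflp_def adj_irrefl intro: adj_sym)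

lemma verts_gap [simp]: "verts gap = {..<n}" by (simp add: gap_def)

lemma dominates_gap [simp]: "u \<rightarrow>\<^bsub>gap\<^esub> v \<longleftrightarrow> u < n \<and> v < n \<and> adj u v"
  by (simp add: gap_def)

lemma not_complete_gap: "\<not> complete_digraph m gap"
proof
  assume "complete_digraph m gap"
  then have "0 \<rightarrow>\<^bsub>gap\<^esub> k"
    using k_pos by (simp add: complete_digraph_def n_def)
  then show False using k_pos by (simp add: adj_def cross_def)
qed

lemma block_less: "block s < D"
  using k_pos unfolding block_def k_def by (simp add: less_mult_imp_div_less)

lemma cross_left: "s < k \<Longrightarrow> 2 * k \<le> w \<Longrightarrow> y * r \<le> s \<Longrightarrow> layer w \<le> Suc y \<Longrightarrow> cross s w"
  using r_pos div_le_mono[of "y * r" s r] by (simp add: cross_def block_def)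

lemma cross_right:
  "s < k \<Longrightarrow> 2 * k \<le> w \<Longrightarrow> y * r \<le> s \<Longrightarrow> layer w \<le> Suc y \<Longrightarrow> cross (k + s) w"
  using r_pos div_le_mono[of "y * r" s r] by (simp add: cross_def block_def)

lemma cross_bottom_layer: "s < 2 * k \<Longrightarrow> i < r \<Longrightarrow> cross s (2 * k + i)"
  by (simp add: cross_def layer_def)

lemma mod_r_shift [simp]: "(2 * k + i) mod r = i mod r"
proof -
  have "2 * k + i = i + (2 * D) * r" by (simp add: k_def)
  then show ?thesis by (metis mod_mult_self1)
qed

text \<open>
  A cut must contain every vertex of the layers below its lowest missing one \<open>w\<close> and all the
  neighbours of \<open>w\<close> in one of the cliques. By the half-graph structure these numbers add up to at
  least \<open>k + r\<close>, wherever \<open>w\<close> is.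
\<close>

lemma le_card_cut:
  assumes "finite X" and s: "s < k" "s \<notin> X" and t: "t \<in> {k..<2 * k}" "t \<notin> X"
    and cut: "\<And>w u v. w \<in> {2 * k..<n} - X \<Longrightarrow> u \<in> {..<k} - X \<Longrightarrow> v \<in> {k..<2 * k} - X \<Longrightarrow>
      \<not> (cross u w \<and> cross v w)"
  shows "2 * k + r \<le> card (X \<union> {..<k}) \<or> 2 * k + r \<le> card (X \<union> {k..<2 * k})"
proof (cases "{2 * k..<n} \<subseteq> X")
  case True
  \<comment> \<open>The layers alone have \<open>k + r\<close> vertices; one clique completes the
    count.\<close>
  have "2 * k + r = card ({..<k} \<union> {2 * k..<n})"
    by (subst card_Un_disjoint) (auto simp: n_def)
  also have "\<dots> \<le> card (X \<union> {..<k})"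
    by (rule card_mono) (use assms(1) True in auto)
  finally show ?thesis ..
next
  case False
  define w where "w = (LEAST w. w \<in> {2 * k..<n} - X)"
  have w: "w \<in> {2 * k..<n} - X"
    unfolding w_def by (rule LeastI_ex) (use False in auto)
  have below_w: "{2 * k..<w} \<subseteq> X"
  proof
    fix x assume "x \<in> {2 * k..<w}"
    then show "x \<in> X"
      using w not_less_Least[of x "\<lambda>w. w \<in> {2 * k..<n} - X"] unfolding w_def by auto
  qed
  \<comment> \<open>The bottom layer sees both cliques completely, so there \<open>w\<close> would
    join \<open>s\<close> to \<open>t\<close>.\<close>
  have "layer w \<noteq> 0"
    using cut[OF w, of s t] s t w by (auto simp: cross_def)
  then obtain y where y: "layer w = Suc y" using not0_implies_Suc by blast
  have "layer w * r \<le> w - 2 * k" unfolding layer_def by simp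
  then have layers: "{2 * k..<2 * k + (y * r + r)} \<subseteq> X"
    using below_w w y by (auto simp: subset_iff)
  have "w - 2 * k < (D + 1) * r"
    using w by (auto simp: n_def k_def)
  then have "layer w < D + 1" unfolding layer_def by (rule less_mult_imp_div_less)
  then have y_le: "y * r \<le> k" using y by (simp add: k_def)
  show ?thesis
  proof (cases "\<exists>u\<in>{..<k} - X. cross u w")
    case True
    \<comment> \<open>As \<open>w\<close> has a neighbour outside \<open>X\<close> in the first
      clique, \<open>X\<close> contains all its neighbours in the second. Adding the first clique
      gives \<open>k + (k - y * r) + (y * r + r)\<close>.\<close>
    then have nocross: "\<not> cross v w" if "v \<in> {k..<2 * k} - X" for v
      using cut[OF w] that by blast
    have "{k + y * r..<2 * k} \<subseteq> X"
    proof
      fix v assume v: "v \<in> {k + y * r..<2 * k}"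
      then have "cross (k + (v - k)) w"
        using w y by (intro cross_right[of _ _ y]) auto
      then show "v \<in> X" using nocross[of v] v by auto
    qed
    moreover have "{k + y * r..<2 * k + (y * r + r)} \<subseteq> {k + y * r..<2 * k} \<union> {2 * k..<2 * k + (y * r + r)}"
      by auto
    ultimately have "{..<k} \<union> {k + y * r..<2 * k + (y * r + r)} \<subseteq> X \<union> {..<k}"
      using layers by blast
    then have "card ({..<k} \<union> {k + y * r..<2 * k + (y * r + r)}) \<le> card (X \<union> {..<k})"
      by (rule card_mono[rotated]) (use assms(1) in simp)
    moreover have "card ({..<k} \<union> {k + y * r..<2 * k + (y * r + r)}) = 2 * k + r"
      by (subst card_Un_disjoint) auto
    ultimately show ?thesis by simp
  next
    case False
    have "{y * r..<k} \<subseteq> X"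
    proof
      fix v assume v: "v \<in> {y * r..<k}"
      then have "cross v w"
        using w y by (intro cross_left[of _ _ y]) auto
      then show "v \<in> X" using False v by auto
    qed
    moreover have "{y * r..<2 * k + (y * r + r)} \<subseteq>
        {y * r..<k} \<union> {k..<2 * k} \<union> {2 * k..<2 * k + (y * r + r)}"
      by auto
    ultimately have "{y * r..<2 * k + (y * r + r)} \<subseteq> X \<union> {k..<2 * k}"
      using layers by blast
    then have "card {y * r..<2 * k + (y * r + r)} \<le> card (X \<union> {k..<2 * k})"
      by (rule card_mono[rotated]) (use assms(1) in simp)
    then show ?thesis by simp
  qed
qed

text \<open>
  The path decomposition trades the blocks of the first clique, from the first to the last, for the
  layers; the second half mirrors this with the second clique.
\<close>

lemma tw_gap: "0 \<le> tw gap" "tw gap \<le> int (k + 2 * r) - 1"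
proof -
  \<comment> \<open>\<open>e t\<close> is the number of blocks missing from the current clique; it
    rises to \<open>D - 1\<close> and falls back to 0.\<close>
  define e where "e t = (if t < D then t else 2 * D - 1 - t)" for t
  define clique_part where
    "clique_part t = (if t < D then {e t * r..<k} else {k + e t * r..<2 * k})" for t
  \<comment> \<open>The layers in the bag, numbered 0 to \<open>e t + 1\<close>, are exactly those
    that block \<open>e t\<close> sees.\<close>
  define bag where "bag t = clique_part t \<union> {2 * k..<2 * k + (e t * r + 2 * r)}" for t
  have e_less: "e t < D" if "t < 2 * D" for t
    using that by (auto simp: e_def)
  have e_r: "e t * r + r \<le> k" if "t < 2 * D" for t
  proof -
    have "Suc (e t) * r \<le> D * r" using e_less[OF that] by (intro mult_le_mono1) simp
    then show ?thesis by (simp add: k_def)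
  qed
  have cover: "(\<Union>t<2 * D. bag t) = verts gap"
  proof
    show "(\<Union>t<2 * D. bag t) \<subseteq> verts gap"
    proof
      fix v assume "v \<in> (\<Union>t<2 * D. bag t)"
      then obtain t where "t < 2 * D" "v \<in> bag t" by blast
      then show "v \<in> verts gap"
        using e_r[of t] by (auto simp: bag_def clique_part_def n_def split: if_splits)
    qed
    have "{..<k} \<subseteq> bag 0" using D_pos by (auto simp: bag_def clique_part_def e_def)
    moreover have "{k..<2 * k} \<subseteq> bag (2 * D - 1)"
      using D_pos by (auto simp: bag_def clique_part_def e_def)
    \<comment> \<open>In the middle of the sequence all \<open>D + 1\<close> layers are
      present.\<close>
    moreover have "{2 * k..<n} \<subseteq> bag (D - 1)"
    proof -
      have "n = 2 * k + (e (D - 1) * r + 2 * r)"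
        using D_pos by (simp add: e_def n_def k_def mult_eq_if[of D r])
      then show ?thesis unfolding bag_def by (metis Un_upper2)
    qed
    moreover have "verts gap \<subseteq> {..<k} \<union> {k..<2 * k} \<union> {2 * k..<n}" by auto
    ultimately have "verts gap \<subseteq> bag 0 \<union> bag (2 * D - 1) \<union> bag (D - 1)" by blast
    moreover have "0 \<in> {..<2 * D}" "2 * D - 1 \<in> {..<2 * D}" "D - 1 \<in> {..<2 * D}"
      using D_pos by auto
    ultimately show "verts gap \<subseteq> (\<Union>t<2 * D. bag t)" by blast
  qed
  have cross_bag: "\<exists>t<2 * D. s \<in> bag t \<and> w \<in> bag t" if c: "cross s w" for s w
  proof -
    have "w - 2 * k < Suc (layer w) * r"
      unfolding layer_def using r_pos by (simp add: dividend_less_div_times)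
    also have "\<dots> \<le> (block s + 2) * r" using c by (intro mult_le_mono1) (simp add: cross_def)
    finally have w: "w \<in> {2 * k..<2 * k + (block s * r + 2 * r)}"
      using c by (auto simp: cross_def algebra_simps)
    have "block s * r \<le> s mod k" by (simp add: block_def)
    then have "s \<in> {block s * r..<k} \<or> s \<in> {k + block s * r..<2 * k}"
      using c by (cases "s < k") (auto simp: cross_def le_mod_geq)
    then show ?thesis
    proof
      assume "s \<in> {block s * r..<k}"
      then show ?thesis using w block_less[of s]
        by (intro exI[of _ "block s"]) (auto simp: bag_def clique_part_def e_def)
    next
      assume "s \<in> {k + block s * r..<2 * k}"
      moreover have "e (2 * D - 1 - block s) = block s" "\<not> 2 * D - 1 - block s < D"
        using block_less[of s] by (auto simp: e_def)
      ultimately show ?thesis using w D_pos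
        by (intro exI[of _ "2 * D - 1 - block s"]) (auto simp: bag_def clique_part_def)
    qed
  qed
  have edges: "\<exists>t<2 * D. u \<in> bag t \<and> v \<in> bag t" if "u \<rightarrow>\<^bsub>gap\<^esub> v" for u v
  proof -
    have uv: "u < n" "v < n" "adj u v" using that by auto
    then consider "u < k" "v < k" | "u \<in> {k..<2 * k}" "v \<in> {k..<2 * k}" | "2 * k \<le> u" "2 * k \<le> v"
      | "cross u v" | "cross v u"
      unfolding adj_def by blast
    then show ?thesis
    proof cases
      case 1
      then show ?thesis
        using D_pos by (intro exI[of _ 0]) (auto simp: bag_def clique_part_def e_def)
    next
      case 2
      then show ?thesis
        using D_pos by (intro exI[of _ "2 * D - 1"]) (auto simp: bag_def clique_part_def e_def)
    next
      case 3
      have "n = 2 * k + (e (D - 1) * r + 2 * r)"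
        using D_pos by (simp add: e_def n_def k_def mult_eq_if[of D r])
      then have "u \<in> bag (D - 1)" "v \<in> bag (D - 1)"
        using 3 uv by (auto simp: bag_def)
      then show ?thesis
        using D_pos by (intro exI[of _ "D - 1"]) simp
    qed (use cross_bag in blast)+
  qed
  have convex: "v \<in> bag j" if bags: "v \<in> bag i" "v \<in> bag l" and ijl: "i \<le> j" "j \<le> l" "l < 2 * D"
    for v i j l
  proof -
    have e_mono: "x * r \<le> y * r" if "x \<le> y" for x y using that by (rule mult_le_mono1)
    consider "v < k" | "v \<in> {k..<2 * k}" | "2 * k \<le> v" by fastforce
    then show ?thesis
    proof cases
      case 1
      then have "l < D" "e l * r \<le> v"
        using bags by (auto simp: bag_def clique_part_def split: if_splits)
      moreover have "j < D" "e j \<le> e l" using ijl \<open>l < D\<close> by (auto simp: e_def)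
      ultimately have "e j * r \<le> v" using e_mono[of "e j" "e l"] by linarith
      then show ?thesis using 1 \<open>j < D\<close> by (simp add: bag_def clique_part_def)
    next
      case 2
      then have "\<not> i < D" "k + e i * r \<le> v"
        using bags by (auto simp: bag_def clique_part_def split: if_splits)
      moreover have "\<not> j < D" "e j \<le> e i" using ijl \<open>\<not> i < D\<close> by (auto simp: e_def)
      ultimately have "k + e j * r \<le> v" using e_mono[of "e j" "e i"] by linarith
      then show ?thesis using 2 \<open>\<not> j < D\<close> by (simp add: bag_def clique_part_def)
    next
      case 3
      then have "v < 2 * k + (e i * r + 2 * r)" "v < 2 * k + (e l * r + 2 * r)"
        using bags by (auto simp: bag_def clique_part_def split: if_splits)
      \<comment> \<open>\<open>e\<close> rises and then falls, so between \<open>i\<close> and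
        \<open>l\<close> it is at least the smaller end value.\<close>
      moreover have "e i \<le> e j \<or> e l \<le> e j" using ijl by (auto simp: e_def)
      ultimately have "v < 2 * k + (e j * r + 2 * r)"
        using e_mono[of "e i" "e j"] e_mono[of "e l" "e j"] by linarith
      then show ?thesis using 3 by (simp add: bag_def)
    qed
  qed
  have size: "card (bag t) \<le> k + 2 * r" if "t < 2 * D" for t
  proof -
    have "card (clique_part t) = k - e t * r"
      by (simp add: clique_part_def)
    then have "card (bag t) \<le> (k - e t * r) + (e t * r + 2 * r)"
      unfolding bag_def using card_Un_le[of "clique_part t"] by (metis card_atLeastLessThan diff_add_inverse)
    then show ?thesis using e_r[OF that] by linarith
  qed
  have ne: "verts gap \<noteq> {}" and pos: "0 < 2 * D"
    using r_pos D_pos by (auto simp: n_def)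
  note tw_bounds = tw_le_path_decomposition[OF pos cover _ _ _ _ ne, where w = "k + 2 * r"]
  show "0 \<le> tw gap"
    by (rule tw_bounds(1)) (fact edges convex size | simp)+
  show "tw gap \<le> int (k + 2 * r) - 1"
    by (rule tw_bounds(2)) (fact edges convex size | simp)+
qed

text \<open>The cliques form one path of \<open>2 * k\<close> vertices, and the columns hang as
  separate paths of \<open>D + 1\<close> vertices below its end \<open>2 * k - 1\<close>.\<close>

lemma td_gap_le: "td gap \<le> 2 * k + D + 1"
proof -
  define up where "up v = (if v < 2 * k then v - 1 else if v < 2 * k + r then 2 * k - 1 else v - r)" for v
  define p where "p v = (if v = 0 \<or> n \<le> v then None else Some (up v))" for v
  define dep where "dep v = (if v < 2 * k then v else 2 * k + layer v)" for v
  have up_less: "up v < v" if "0 < v" for v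
    using that r_pos k_pos by (auto simp: up_def)
  have p_iff: "p v = Some u \<longleftrightarrow> 0 < v \<and> v < n \<and> u = up v" for u v
    by (auto simp: p_def)
  have "acyclic ({(u, v). p v = Some u}\<inverse>)"
    by (rule acyclicI_order[where f = id]) (auto simp: p_iff up_less)
  then have "rooted_forest {..<n} p"
    using up_less by (auto simp: rooted_forest_def dom_def ran_def p_iff intro: less_trans)
  moreover have anc: "ancestor p u v" if "u < v" "v < n" "u < 2 * k \<or> u mod r = v mod r" for u v
    using that
  proof (induction v rule: less_induct)
    case (less v)
    have "u \<le> up v \<and> (u < 2 * k \<or> u mod r = up v mod r)"
    proof -
      consider "v < 2 * k" | "2 * k \<le> v" "v < 2 * k + r" | "2 * k + r \<le> v" by linarith
      then show ?thesis
      proof cases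
        case 1
        then show ?thesis using less.prems by (auto simp: up_def)
      next
        case 2
        then obtain i where i: "v = 2 * k + i" "i < r" using le_Suc_ex by auto
        \<comment> \<open>The bottom layer holds the least vertex of each column, so a smaller
          \<open>u\<close> is a clique vertex.\<close>
        have "u < 2 * k"
        proof (rule ccontr)
          assume "\<not> u < 2 * k"
          then obtain i' where i': "u = 2 * k + i'" using le_Suc_ex not_less by blast
          then show False using i less.prems by simp
        qed
        then show ?thesis using 2 by (auto simp: up_def)
      next
        case 3
        \<comment> \<open>Distinct vertices of a column differ by at least \<open>r\<close>, so
          \<open>u\<close> does not pass the parent \<open>v - r\<close>.\<close>
        have "r \<le> v - u" if "u mod r = v mod r"
        proof -
          have "r dvd v - u" using that less.prems(1) mod_eq_dvd_iff_nat[of u v r] by simp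
          then show ?thesis using less.prems(1) by (intro dvd_imp_le) auto
        qed
        then show ?thesis
          using 3 less.prems by (auto simp: up_def le_mod_geq)
      qed
    qed
    moreover have edge: "(up v, v) \<in> {(u, v). p v = Some u}"
      using less.prems by (auto simp: p_iff)
    moreover have "ancestor p u (up v)" if "u < up v" "u < 2 * k \<or> u mod r = up v mod r"
      using less.IH[of "up v"] that up_less[of v] less.prems by linarith
    ultimately show ?case
      unfolding ancestor_def by (metis le_neq_implies_less r_into_trancl trancl.trancl_into_trancl)
  qed
  ultimately have dec: "treedepth_decomposition gap p"
    unfolding treedepth_decomposition_def
  proof (intro conjI allI impI)
    fix u v assume "u \<rightarrow>\<^bsub>gap\<^esub> v"
    then have uv: "u < n" "v < n" "adj u v" by auto
    then have "u < v \<and> (u < 2 * k \<or> u mod r = v mod r) \<or> v < u \<and> (v < 2 * k \<or> v mod r = u mod r)"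
      by (auto simp: adj_def cross_def)
    then show "ancestor p u v \<or> ancestor p v u" using anc uv by blast
  qed simp
  have "forest_height {..<n} p \<le> 2 * k + D + 1"
  proof (rule forest_height_le[where dep = dep])
    show "dep v = 0" if "v \<in> {..<n}" "p v = None" for v
      using that k_pos by (auto simp: p_def dep_def split: if_splits)
    show "dep v = Suc (dep u)" if "v \<in> {..<n}" "p v = Some u" for u v
    proof -
      have u: "u = up v" "0 < v" using that by (auto simp: p_iff)
      consider "v < 2 * k" | "2 * k \<le> v" "v < 2 * k + r" | "2 * k + r \<le> v" by linarith
      then show ?thesis
      proof cases
        case 1
        then show ?thesis using u by (simp add: up_def dep_def)
      next
        case 2
        then show ?thesis using u k_pos by (simp add: up_def dep_def layer_def)
      next
        case 3
        then have "layer v = Suc (layer (v - r))"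
          using r_pos le_div_geq[of r "v - 2 * k"] by (simp add: layer_def diff_commute add.commute)
        then show ?thesis using 3 u by (simp add: up_def dep_def)
      qed
    qed
    show "dep v < 2 * k + D + 1" if "v \<in> {..<n}" for v
    proof (cases "v < 2 * k")
      case False
      then have "v - 2 * k < (D + 1) * r" using that by (auto simp: n_def k_def)
      then have "layer v < D + 1" unfolding layer_def by (rule less_mult_imp_div_less)
      then show ?thesis using False by (simp add: dep_def)
    qed (simp add: dep_def)
  qed
  then show ?thesis using td_le[OF dec] by simp
qed

end

section \<open>Low decompositions after deleting a vertex set\<close>

text \<open>Meant for a td-optimal separator \<open>Y\<close> and an optimal decomposition
  \<open>p\<close> of the rest; \<open>low\<close> then follows from
  \<open>td gap \<le> 2 * k + D + 1\<close> and \<open>r = D + 2\<close>.\<close>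

locale gap_decomposition = gap_graph +
  fixes Y :: "nat set" and p :: "nat \<rightharpoonup> nat"
  assumes Y_sub: "Y \<subseteq> {..<n}"
    and decomposition: "treedepth_decomposition (delete_verts gap Y) p"
    and low: "card Y + forest_height ({..<n} - Y) p < 2 * k + r"
begin

sublocale finite_forest "{..<n} - Y" p
  using decomposition by unfold_locales (simp_all add: treedepth_decomposition_def delete_verts_def)

lemma finite_Y: "finite Y"
  using Y_sub by (rule finite_subset) simp

lemma comparable_if_adj: "adj u v \<Longrightarrow> u \<in> {..<n} - Y \<Longrightarrow> v \<in> {..<n} - Y \<Longrightarrow> comparable u v"
  using decomposition
  by (simp add: treedepth_decomposition_def dominates_delete_verts_iff comparable_def)

text \<open>\<open>Y\<close> counts as if it were stacked on top of the forest, so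
  \<open>low\<close> bounds \<open>Y\<close> together with any chain.\<close>

lemma card_Un_chain_less:
  assumes "C \<subseteq> {..<n}" and "\<And>u v. u \<in> C - Y \<Longrightarrow> v \<in> C - Y \<Longrightarrow> comparable u v"
  shows "card (Y \<union> C) < 2 * k + r"
proof -
  have "card (Y \<union> C) \<le> card Y + card (C - Y)"
    using card_Un_le[of Y "C - Y"] by simp
  also have "card (C - Y) \<le> forest_height ({..<n} - Y) p"
    by (rule card_chain_le_height) (use assms in auto)
  finally show ?thesis using low by linarith
qed

lemma comparable_left:
  "u \<in> {..<k} - Y \<Longrightarrow> v \<in> {..<k} - Y \<Longrightarrow> comparable u v"
  by (cases "u = v") (auto simp: comparable_refl n_def adj_def intro!: comparable_if_adj)

lemma comparable_right:
  "u \<in> {k..<2 * k} - Y \<Longrightarrow> v \<in> {k..<2 * k} - Y \<Longrightarrow> comparable u v"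
  by (cases "u = v") (auto simp: comparable_refl n_def adj_def intro!: comparable_if_adj)

lemma comparable_cross:
  "cross s w \<Longrightarrow> s \<notin> Y \<Longrightarrow> w \<in> {..<n} - Y \<Longrightarrow> comparable s w"
  by (rule comparable_if_adj) (auto simp: adj_def cross_def n_def)

text \<open>Otherwise \<open>Y\<close> and the common ancestors of \<open>s\<close> and
  \<open>t\<close> form a cut as in \<open>le_card_cut\<close>. These ancestors form a chain with
  what remains of either clique, so the size forced there contradicts \<open>low\<close>.\<close>

lemma comparable_left_right:
  assumes s: "s \<in> {..<k} - Y" and t: "t \<in> {k..<2 * k} - Y"
  shows "comparable s t"
proof (rule ccontr)
  assume incomparable: "\<not> comparable s t"
  define A where "A = {u \<in> {..<n} - Y. ancestor p u s \<and> ancestor p u t}"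
  have notin: "s \<notin> Y \<union> A" "t \<notin> Y \<union> A"
    using s t ancestor_irrefl by (auto simp: A_def)
  have "2 * k + r \<le> card (Y \<union> A \<union> {..<k}) \<or> 2 * k + r \<le> card (Y \<union> A \<union> {k..<2 * k})"
  proof (rule le_card_cut)
    show "finite (Y \<union> A)" using finite_Y by (simp add: A_def)
  next
    fix w u v
    assume w: "w \<in> {2 * k..<n} - (Y \<union> A)" and u: "u \<in> {..<k} - (Y \<union> A)"
      and v: "v \<in> {k..<2 * k} - (Y \<union> A)"
    show "\<not> (cross u w \<and> cross v w)"
    proof
      assume "cross u w \<and> cross v w"
      then have walk: "comparable u s" "comparable w u" "comparable v w" "comparable t v"
        using comparable_left[of u s] comparable_right[of t v] comparable_cross comparable_sym u v w s t
        by auto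
      \<comment> \<open>The walk \<open>s\<close>, \<open>u\<close>, \<open>w\<close>,
        \<open>v\<close>, \<open>t\<close> is built up vertex by vertex. Its topmost vertex is a
        common ancestor of \<open>s\<close> and \<open>t\<close>, although the walk avoids
        \<open>A\<close>.\<close>
      have "\<exists>x\<in>{u, s}. \<forall>c\<in>{u, s}. ancestor_eq x c"
        by (rule topmost_insert[OF _ _ walk(1)]) simp_all
      then have "\<exists>x\<in>{w, u, s}. \<forall>c\<in>{w, u, s}. ancestor_eq x c"
        by (rule topmost_insert[OF _ _ walk(2)]) simp
      then have "\<exists>x\<in>{v, w, u, s}. \<forall>c\<in>{v, w, u, s}. ancestor_eq x c"
        by (rule topmost_insert[OF _ _ walk(3)]) simp
      then have "\<exists>x\<in>{t, v, w, u, s}. \<forall>c\<in>{t, v, w, u, s}. ancestor_eq x c"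
        by (rule topmost_insert[OF _ _ walk(4)]) simp
      then obtain x where x: "x \<in> {t, v, w, u, s}" and above: "\<forall>c\<in>{t, v, w, u, s}. ancestor_eq x c"
        by (rule bexE)
      have "ancestor_eq x s" "ancestor_eq x t" using above by simp_all
      then have "ancestor p x s \<and> ancestor p x t"
        using incomparable by (auto simp: ancestor_eq_def comparable_def)
      moreover have "x \<in> {..<n} - Y" using x s t u v w by (auto simp: n_def)
      ultimately have "x \<in> A" by (simp add: A_def)
      then show False using x notin u v w by blast
    qed
  qed (use s t notin in auto)
  moreover have "card (Y \<union> (A \<union> {..<k})) < 2 * k + r"
  proof (rule card_Un_chain_less)
    show "comparable u v" if "u \<in> A \<union> {..<k} - Y" "v \<in> A \<union> {..<k} - Y" for u v
      by (rule comparable_Un_ancestors[of A s "{..<k} - Y"])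
        (use that s comparable_left in \<open>auto simp: A_def ancestor_eq_def\<close>)
  qed (auto simp: A_def n_def)
  moreover have "card (Y \<union> (A \<union> {k..<2 * k})) < 2 * k + r"
  proof (rule card_Un_chain_less)
    show "comparable u v" if "u \<in> A \<union> {k..<2 * k} - Y" "v \<in> A \<union> {k..<2 * k} - Y" for u v
      by (rule comparable_Un_ancestors[of A t "{k..<2 * k} - Y"])
        (use that t comparable_right in \<open>auto simp: A_def ancestor_eq_def\<close>)
  qed (auto simp: A_def n_def)
  ultimately show False by (simp add: Un_assoc)
qed

lemma comparable_cliques:
  assumes "u \<in> {..<2 * k} - Y" "v \<in> {..<2 * k} - Y"
  shows "comparable u v"
proof -
  have "{..<2 * k} - Y = ({..<k} - Y) \<union> ({k..<2 * k} - Y)" by auto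
  then show ?thesis
    using assms comparable_left comparable_right comparable_left_right comparable_sym by blast
qed

text \<open>If \<open>K\<close> split the remaining clique vertices, \<open>Y\<close> itself would
  be a cut, and \<open>Y\<close> with one of the cliques would violate \<open>low\<close>.\<close>

lemma same_side_of_cut:
  assumes closed: "\<And>u v. u \<in> {..<n} - Y \<Longrightarrow> v \<in> {..<n} - Y \<Longrightarrow> adj u v \<Longrightarrow> u \<in> K \<longleftrightarrow> v \<in> K"
    and "u \<in> {..<2 * k} - Y" "v \<in> {..<2 * k} - Y"
  shows "u \<in> K \<longleftrightarrow> v \<in> K"
proof -
  have left: "u \<in> K \<longleftrightarrow> v \<in> K" if "u \<in> {..<k} - Y" "v \<in> {..<k} - Y" for u v
    using that closed[of u v] by (cases "u = v") (auto simp: adj_def n_def)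
  have right: "u \<in> K \<longleftrightarrow> v \<in> K" if "u \<in> {k..<2 * k} - Y" "v \<in> {k..<2 * k} - Y" for u v
    using that closed[of u v] by (cases "u = v") (auto simp: adj_def n_def)
  have left_right: "s \<in> K \<longleftrightarrow> t \<in> K" if s: "s \<in> {..<k} - Y" and t: "t \<in> {k..<2 * k} - Y" for s t
  proof (rule ccontr)
    assume differ: "(s \<in> K) \<noteq> (t \<in> K)"
    have "2 * k + r \<le> card (Y \<union> {..<k}) \<or> 2 * k + r \<le> card (Y \<union> {k..<2 * k})"
    proof (rule le_card_cut)
      fix w u v
      assume w: "w \<in> {2 * k..<n} - Y" and u: "u \<in> {..<k} - Y" and v: "v \<in> {k..<2 * k} - Y"
      show "\<not> (cross u w \<and> cross v w)"
      proof
        assume "cross u w \<and> cross v w"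
        then have "adj u w" "adj v w" by (auto simp: adj_def cross_def)
        then have "u \<in> K \<longleftrightarrow> w \<in> K" "v \<in> K \<longleftrightarrow> w \<in> K"
          using closed u v w by (auto simp: n_def)
        then show False using left[OF s u] right[OF t v] differ by blast
      qed
    qed (use s t finite_Y in auto)
    moreover have "card (Y \<union> {..<k}) < 2 * k + r"
      by (rule card_Un_chain_less) (use comparable_left in \<open>auto simp: n_def\<close>)
    moreover have "card (Y \<union> {k..<2 * k}) < 2 * k + r"
      by (rule card_Un_chain_less) (use comparable_right in \<open>auto simp: n_def\<close>)
    ultimately show False by linarith
  qed
  have "{..<2 * k} - Y = ({..<k} - Y) \<union> ({k..<2 * k} - Y)" by auto
  then show ?thesis
    using assms(2,3) left right left_right by blast
qed

text \<open>Let \<open>z\<close> be the lowest clique vertex left. If it is above a bottom vertex of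
  another column, that intact column prolongs the path; if not, what remains of the bottom layer is
  above \<open>z\<close>. Either way, \<open>Y\<close> and a chain reach \<open>2 * k + r\<close>
  vertices.\<close>

lemma cliques_subset_if_column:
  assumes j: "j < r" "2 * k + j \<in> Y" and column: "\<And>y. y \<in> Y \<Longrightarrow> 2 * k \<le> y \<Longrightarrow> y mod r = j"
  shows "{..<2 * k} \<subseteq> Y"
proof (rule ccontr)
  assume "\<not> {..<2 * k} \<subseteq> Y"
  then obtain z where z: "z \<in> {..<2 * k} - Y" "\<forall>c\<in>{..<2 * k} - Y. ancestor_eq c z"
    using chain_has_bottom[of "{..<2 * k} - Y"] comparable_cliques by blast
  have bottom_notin: "2 * k + i \<in> {..<n} - Y" if "i < r" "i \<noteq> j" for i
    using that column[of "2 * k + i"] k_pos by (auto simp: n_def)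
  show False
  proof (cases "\<exists>i<r. i \<noteq> j \<and> ancestor_eq z (2 * k + i)")
    case True
    then obtain i where i: "i < r" "i \<noteq> j" "ancestor_eq z (2 * k + i)" by blast
    \<comment> \<open>Column \<open>i\<close>, which avoids \<open>Y\<close> because the layer
      vertices of \<open>Y\<close> are all in column \<open>j\<close>.\<close>
    define Q where "Q = (\<lambda>l. 2 * k + (i + l * r)) ` {..D}"
    have "inj (\<lambda>l. 2 * k + (i + l * r))" using r_pos by (simp add: inj_def)
    then have card_Q: "card Q = D + 1" by (simp add: Q_def card_image inj_on_def)
    have Q_sub: "Q \<subseteq> {2 * k..<n} - Y"
    proof
      fix x assume "x \<in> Q"
      then obtain l where l: "l \<le> D" "x = 2 * k + (i + l * r)" by (auto simp: Q_def)
      have "l * r \<le> k" using l by (simp add: k_def)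
      moreover have "x mod r = i" using i(1) by (simp add: l)
      ultimately show "x \<in> {2 * k..<n} - Y"
        using i l column[of x] by (auto simp: n_def)
    qed
    have Q_chain: "comparable u v" if "u \<in> Q" "v \<in> Q" for u v
    proof (cases "u = v")
      case False
      have "u mod r = i" "v mod r = i" using that i(1) by (auto simp: Q_def)
      then have "adj u v" using that False Q_sub by (auto simp: adj_def)
      then show ?thesis using comparable_if_adj that Q_sub by fastforce
    qed (simp add: comparable_iff)
    have "2 * k + i \<in> Q" unfolding Q_def by (rule image_eqI[of _ _ 0]) auto
    then have "comparable u v" if "u \<in> {..<2 * k} - Y \<union> Q" "v \<in> {..<2 * k} - Y \<union> Q" for u v
      using comparable_Un_ancestors[OF _ _ Q_chain that, of "2 * k + i"] z i(3) ancestor_eq_trans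
      by blast
    then have "card (Y \<union> ({..<2 * k} \<union> Q)) < 2 * k + r"
      by (intro card_Un_chain_less) (use Q_sub in \<open>auto simp: n_def\<close>)
    \<comment> \<open>The deleted vertex \<open>2 * k + j\<close> is the one that raises
      \<open>D + 1\<close> to \<open>r\<close>.\<close>
    moreover have "card ({..<2 * k} \<union> (insert (2 * k + j) Q)) = 2 * k + r"
    proof -
      have "2 * k + j \<notin> Q" using Q_sub j by auto
      then have "card (insert (2 * k + j) Q) = r" using card_Q by (simp add: Q_def r_def)
      then show ?thesis using Q_sub by (subst card_Un_disjoint) (auto simp: Q_def)
    qed
    moreover have "card ({..<2 * k} \<union> (insert (2 * k + j) Q)) \<le> card (Y \<union> ({..<2 * k} \<union> Q))"
      by (rule card_mono) (use j finite_Y in \<open>auto simp: Q_def\<close>)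
    ultimately show False by simp
  next
    case False
    \<comment> \<open>\<open>z\<close> sees the whole bottom layer, so the vertices left there are
      comparable to \<open>z\<close> and, in this case, above it.\<close>
    have "ancestor_eq (2 * k + i) z" if "i < r" "i \<noteq> j" for i
    proof -
      have "comparable z (2 * k + i)"
        using comparable_cross cross_bottom_layer[of z i] z(1) that bottom_notin[OF that] by auto
      then show ?thesis using False that by (auto simp: comparable_iff)
    qed
    then have "ancestor_eq u z" if "u \<in> {..<2 * k + r} - Y" for u
    proof (cases "u < 2 * k")
      case False
      then obtain i where i: "u = 2 * k + i" using le_Suc_ex not_less by blast
      then have "i < r" "i \<noteq> j" using that j by auto
      then show ?thesis using \<open>\<And>i. i < r \<Longrightarrow> i \<noteq> j \<Longrightarrow> ancestor_eq (2 * k + i) z\<close> i by blast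
    qed (use z(2) that in auto)
    then have "card (Y \<union> {..<2 * k + r}) < 2 * k + r"
      by (intro card_Un_chain_less) (auto simp: n_def intro: comparable_if_common_descendant)
    moreover have "card {..<2 * k + r} \<le> card (Y \<union> {..<2 * k + r})"
      by (rule card_mono) (use finite_Y in auto)
    ultimately show False by simp
  qed
qed

end

text \<open>If a clique vertex \<open>z\<close> is left, one side of the cut avoids \<open>z\<close>
  and hence all clique vertices. It lies in the layers, where edges stay within columns, so
  minimality confines the layer vertices of \<open>Y\<close> to the column of
  \<open>a\<close>.\<close>

lemma (in gap_graph) cliques_subset_td_optimal_separator:
  assumes "Y \<in> td_optimal_separators gap"
  shows "{..<2 * k} \<subseteq> Y"
proof (rule ccontr)
  assume not_sub: "\<not> {..<2 * k} \<subseteq> Y"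
  then obtain z where z: "z \<in> {..<2 * k} - Y" by blast
  interpret gap: graph gap by (rule graph_gap)
  note sep_iff = separator_iff_closed_set[OF gap.sym_digraph_axioms, unfolded verts_gap]
  obtain a0 b0 where min0: "minimal_separator gap a0 b0 Y" and td: "td gap = card Y + td (delete_verts gap Y)"
    using assms by (auto simp: td_optimal_separators_def minimal_separators_def)
  have Y_sub: "Y \<subseteq> {..<n}"
    using min0 by (auto simp: minimal_separator_def separator_def)
  have "fin_digraph (delete_verts gap Y)"
    unfolding delete_verts_def
    by (rule gap.fin_digraph_subgraph) (auto intro: gap.subgraph_induce_subgraphI)
  then obtain p where "treedepth_decomposition (delete_verts gap Y) p"
    "forest_height (verts (delete_verts gap Y)) p = td (delete_verts gap Y)"
    by (rule td_attained) (auto simp: dominates_delete_verts_iff adj_irrefl)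
  then interpret gap_decomposition D Y p
    using Y_sub td td_gap_le
    by unfold_locales (simp_all add: delete_verts_def r_def)
  have sep_sym: "separator gap a b S \<longleftrightarrow> separator gap b a S" for a b S
    unfolding separator_def by (auto simp: insert_commute)
  obtain K0 where K0: "K0 \<subseteq> {..<n} - Y" "a0 \<in> K0" "b0 \<in> {..<n} - Y - K0"
    and closed0: "\<forall>u\<in>K0. \<forall>v\<in>{..<n} - Y. u \<rightarrow>\<^bsub>gap\<^esub> v \<longrightarrow> v \<in> K0"
    using min0 unfolding minimal_separator_def sep_iff by (elim conjE exE) (rule that)
  have bi_closed0: "u \<in> K0 \<longleftrightarrow> v \<in> K0" if "u \<in> {..<n} - Y" "v \<in> {..<n} - Y" "adj u v" for u v
    using closed0 that adj_sym by auto
  \<comment> \<open>The side without \<open>z\<close> is chosen, exchanging \<open>a0\<close> and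
    \<open>b0\<close> and complementing \<open>K0\<close> if needed.\<close>
  obtain a b K where minimal: "minimal_separator gap a b Y"
    and K: "K \<subseteq> {..<n} - Y" "a \<in> K" "b \<in> {..<n} - Y - K" "z \<notin> K"
    and closed: "\<And>u v. u \<in> {..<n} - Y \<Longrightarrow> v \<in> {..<n} - Y \<Longrightarrow> adj u v \<Longrightarrow> u \<in> K \<longleftrightarrow> v \<in> K"
  proof (cases "z \<in> K0")
    case True
    have "minimal_separator gap b0 a0 Y"
      using min0 sep_sym unfolding minimal_separator_def by blast
    then show thesis
      by (rule that[of b0 a0 "{..<n} - Y - K0"]) (use K0 True bi_closed0 in auto)
  next
    case False
    show thesis
      by (rule that[OF min0, of K0]) (use K0 False bi_closed0 in auto)
  qed
  have K_high: "2 * k \<le> u" if "u \<in> K" for u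
    using same_side_of_cut[OF closed z, of u] that K by (cases "u < 2 * k") auto
  define j where "j = a mod r"
  have j: "j < r" using r_pos by (simp add: j_def)
  \<comment> \<open>Otherwise the least vertex of the column of \<open>a\<close>, a neighbour of
    \<open>z\<close>, would connect \<open>K\<close> to \<open>z\<close>.\<close>
  have "2 * k + j \<in> Y"
  proof (rule ccontr)
    assume "2 * k + j \<notin> Y"
    then have bottom: "2 * k + j \<in> {..<n} - Y" using j by (simp add: n_def)
    have "2 * k + j \<in> K"
    proof (cases "a = 2 * k + j")
      case False
      have "(2 * k + j) mod r = a mod r" by (simp add: j_def)
      then have "adj a (2 * k + j)" using False K_high[OF K(2)] by (simp add: adj_def)
      then show ?thesis using closed[OF _ bottom] K by blast
    qed (use K in simp)
    moreover have "adj z (2 * k + j)"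
      using cross_bottom_layer[of z j] z j by (auto simp: adj_def)
    moreover have "z \<in> {..<n} - Y" using z by (simp add: n_def)
    ultimately show False using closed[OF _ bottom] K(4) by blast
  qed
  moreover have "y mod r = j" if y: "y \<in> Y" "2 * k \<le> y" for y
  proof (rule ccontr)
    assume other: "y mod r \<noteq> j"
    \<comment> \<open>Restoring a vertex of another column gives no new edge out of the part of
      \<open>K\<close> in column \<open>j\<close>.\<close>
    have "separator gap a b (Y - {y})"
      unfolding sep_iff
    proof (intro conjI exI[of _ "{u \<in> K. u mod r = j}"] ballI impI)
      fix u v assume u: "u \<in> {u \<in> K. u mod r = j}" and v: "v \<in> {..<n} - (Y - {y})" "u \<rightarrow>\<^bsub>gap\<^esub> v"
      have adj_uv: "adj u v" using v by simp
      have same_column: "v mod r = j" if "2 * k \<le> v"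
      proof -
        have "2 * k \<le> u" using u K_high by blast
        then have "u mod r = v mod r" using that adj_uv k_pos by (simp add: adj_def cross_def)
        then show ?thesis using u by simp
      qed
      then have "v \<noteq> y" using y other by blast
      then have "v \<in> K" using closed[OF _ _ adj_uv] u v K(1) by blast
      then show "v \<in> {u \<in> K. u mod r = j}" using same_column K_high by blast
    qed (use Y_sub K y in \<open>auto simp: j_def\<close>)
    then show False using minimal y by (auto simp: minimal_separator_def)
  qed
  ultimately show False using cliques_subset_if_column[OF j] not_sub by blast
qed

theorem theorem3:
  fixes c :: real
  assumes "c < 2"
  shows "\<exists>G :: (nat, nat \<times> nat) pre_digraph.
    graph G \<and> \<not> (\<exists>n. complete_digraph n G) \<and>
    (\<forall>S \<in> td_optimal_separators G. real (card S) > c * real_of_int (tw G))"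
proof -
  \<comment> \<open>With parameter \<open>Suc D\<close>, the ratio of \<open>2 * k\<close> to
    \<open>k + 2 * r\<close> is \<open>2 * (D + 1) / (D + 3)\<close>, and this \<open>D\<close>
    makes it at least \<open>c\<close>.\<close>
  obtain D :: nat where D: "2 * c / (2 - c) < real D"
    using reals_Archimedean2 by blast
  interpret gap_graph "Suc D" by unfold_locales simp
  have "real (card S) > c * real_of_int (tw gap)" if S: "S \<in> td_optimal_separators gap" for S
  proof -
    have "S \<subseteq> {..<n}"
      using S by (auto simp: td_optimal_separators_def minimal_separators_def
          minimal_separator_def separator_def)
    then have "2 * k \<le> card S"
      using card_mono[OF finite_subset cliques_subset_td_optimal_separator[OF S]] by fastforce
    then have card_S: "2 * real k \<le> real (card S)" by linarith
    have tw: "0 \<le> real_of_int (tw gap)" "real_of_int (tw gap) < real (k + 2 * r)"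
      using tw_gap by linarith+
    show ?thesis
    proof (cases "0 < c")
      case True
      have "2 * c < real D * (2 - c)" using D assms by (simp add: divide_less_eq)
      then have "c * real (D + 3) \<le> 2 * real (Suc D)" using assms by (simp add: algebra_simps)
      then have "c * real (D + 3) * real r \<le> 2 * real (Suc D) * real r"
        by (rule mult_right_mono) simp
      moreover have "real (k + 2 * r) = real (D + 3) * real r" by (simp add: k_def algebra_simps)
      ultimately have "c * real (k + 2 * r) \<le> 2 * real k" by (simp add: k_def algebra_simps)
      moreover have "c * real_of_int (tw gap) < c * real (k + 2 * r)"
        using tw True by simp
      ultimately show ?thesis using card_S by linarith
    next
      case False
      then have "c * real_of_int (tw gap) \<le> 0" using tw by (simp add: mult_nonpos_nonneg)
      then show ?thesis using card_S k_pos by linarith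
    qed
  qed
  then show ?thesis using graph_gap not_complete_gap by blast
qed

end
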